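(* Let $E=\mathrm{End}(\mathbb{Q},\le)$, let $C\subseteq E$ be the set of constant maps $\mathbb{Q}\to\mathbb{Q}$, let $M\subseteq E$ be the set of injective members of $E$, let $S\subseteq E$ be the set of surjective members of $E$, and let $G=\mathrm{Aut}(\mathbb{Q},\le)$. Then each of $C$, $M$, $S$, $G$ is a definable subset of the monoid $E$. More precisely: (1) $C$ is exactly the set of left absorbing (left zero) elements of $E$, i.e. $C=\{g\in E\colon gf=g \text{ for all } f\in E\}$; (2) $M$ is exactly the set of monomorphisms, i.e. of those $f\in E$ such that for all $g,h\in E$, $fg=fh$ implies $g=h$; (3) $S$ is exactly the set of epimorphisms, i.e. of those $f\in E$ such that for all $g,h\in E$, $gf=hf$ implies $g=h$; (4) $G$ is exactly the set of isomorphisms inside $E$, i.e. of elements of $E$ having a two-sided inverse in $E$.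
   Context: $\mathrm{End}(\mathbb{Q},\le)$ is the monoid of all weakly order-preserving maps $\mathbb{Q}\to\mathbb{Q}$ under composition, $(gf)(x)=g(f(x))$. "Definable" means first-order definable in the language of monoids. *)

theory Defs
  imports Complex_Main "HOL-Algebra.Group"
begin

text \<open>First-order logic with equality over the signature of monoids: one binary function symbol
  and one constant symbol. Variables are named by natural numbers.\<close>

datatype mon_term =
    Var nat
  | Unit
  | Times mon_term mon_term

datatype mon_fm =
    Equal mon_term mon_term
  | Neg mon_fm
  | Conj mon_fm mon_fm
  | Disj mon_fm mon_fm
  | Impl mon_fm mon_fm
  | All nat mon_fm
  | Ex nat mon_fm

primrec fv_term :: "mon_term \<Rightarrow> nat set" where
  "fv_term (Var n) = {n}"
| "fv_term Unit = {}"
| "fv_term (Times s t) = fv_term s \<union> fv_term t"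

primrec fv :: "mon_fm \<Rightarrow> nat set" where
  "fv (Equal s t) = fv_term s \<union> fv_term t"
| "fv (Neg \<phi>) = fv \<phi>"
| "fv (Conj \<phi> \<psi>) = fv \<phi> \<union> fv \<psi>"
| "fv (Disj \<phi> \<psi>) = fv \<phi> \<union> fv \<psi>"
| "fv (Impl \<phi> \<psi>) = fv \<phi> \<union> fv \<psi>"
| "fv (All n \<phi>) = fv \<phi> - {n}"
| "fv (Ex n \<phi>) = fv \<phi> - {n}"

primrec eval_term :: "('a, 'b) monoid_scheme \<Rightarrow> (nat \<Rightarrow> 'a) \<Rightarrow> mon_term \<Rightarrow> 'a" where
  "eval_term A e (Var n) = e n"
| "eval_term A e Unit = \<one>\<^bsub>A\<^esub>"
| "eval_term A e (Times s t) = eval_term A e s \<otimes>\<^bsub>A\<^esub> eval_term A e t"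

primrec sat :: "('a, 'b) monoid_scheme \<Rightarrow> (nat \<Rightarrow> 'a) \<Rightarrow> mon_fm \<Rightarrow> bool" where
  "sat A e (Equal s t) \<longleftrightarrow> eval_term A e s = eval_term A e t"
| "sat A e (Neg \<phi>) \<longleftrightarrow> \<not> sat A e \<phi>"
| "sat A e (Conj \<phi> \<psi>) \<longleftrightarrow> sat A e \<phi> \<and> sat A e \<psi>"
| "sat A e (Disj \<phi> \<psi>) \<longleftrightarrow> sat A e \<phi> \<or> sat A e \<psi>"
| "sat A e (Impl \<phi> \<psi>) \<longleftrightarrow> (sat A e \<phi> \<longrightarrow> sat A e \<psi>)"
| "sat A e (All n \<phi>) \<longleftrightarrow> (\<forall>a\<in>carrier A. sat A (e(n := a)) \<phi>)"
| "sat A e (Ex n \<phi>) \<longleftrightarrow> (\<exists>a\<in>carrier A. sat A (e(n := a)) \<phi>)"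

text \<open>Definability is without parameters. As the formula has no free variable other than variable
  0, the values that the constant assignment gives to the other variables are irrelevant.\<close>

definition definable_in :: "('a, 'b) monoid_scheme \<Rightarrow> 'a set \<Rightarrow> bool" where
  "definable_in A X \<longleftrightarrow> (\<exists>\<phi>. fv \<phi> \<subseteq> {0} \<and> X = {a \<in> carrier A. sat A (\<lambda>_. a) \<phi>})"

definition End_Q :: "(rat \<Rightarrow> rat) monoid" where
  "End_Q = \<lparr>carrier = {f. mono f}, mult = (\<circ>), one = id\<rparr>"

lemma monoid_End_Q: "monoid End_Q"
  by unfold_locales (auto simp: End_Q_def mono_def o_assoc)

definition const_Q :: "(rat \<Rightarrow> rat) set" where
  "const_Q = {f. \<exists>c. \<forall>x. f x = c}"

definition inj_End_Q :: "(rat \<Rightarrow> rat) set" where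
  "inj_End_Q = {f \<in> carrier End_Q. inj f}"

definition surj_End_Q :: "(rat \<Rightarrow> rat) set" where
  "surj_End_Q = {f \<in> carrier End_Q. surj f}"

definition Aut_Q :: "(rat \<Rightarrow> rat) set" where
  "Aut_Q = {f. bij f \<and> (\<forall>x y. x \<le> y \<longleftrightarrow> f x \<le> f y)}"

definition left_zeros :: "('a, 'b) monoid_scheme \<Rightarrow> 'a set" where
  "left_zeros A = {g \<in> carrier A. \<forall>f\<in>carrier A. g \<otimes>\<^bsub>A\<^esub> f = g}"

definition monomorphisms :: "('a, 'b) monoid_scheme \<Rightarrow> 'a set" where
  "monomorphisms A = {f \<in> carrier A. \<forall>g\<in>carrier A. \<forall>h\<in>carrier A.
     f \<otimes>\<^bsub>A\<^esub> g = f \<otimes>\<^bsub>A\<^esub> h \<longrightarrow> g = h}"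

definition epimorphisms :: "('a, 'b) monoid_scheme \<Rightarrow> 'a set" where
  "epimorphisms A = {f \<in> carrier A. \<forall>g\<in>carrier A. \<forall>h\<in>carrier A.
     g \<otimes>\<^bsub>A\<^esub> f = h \<otimes>\<^bsub>A\<^esub> f \<longrightarrow> g = h}"

end

theory Submission
  imports Defs
begin

text \<open>
  Once each of the four sets is recognised as the set of left zeros, monomorphisms, epimorphisms or
  units, it is definable by a general fact: in every monoid, each of these notions is expressed by a
  formula that quantifies over elements only.

  The recognition itself rests on \<open>E\<close> having enough test maps. Composing with a constant map on the
  right evaluates a map at a point, so a left zero agrees everywhere with its value at one point, and
  a left cancellable map separates points. Dually, a point \<open>q\<close> outside the range of \<open>f\<close> is detected
  by composing on the left with the two step maps that jump from \<open>0\<close> to \<open>1\<close> at \<open>q\<close>: the one whose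
  value at \<open>q\<close> is \<open>0\<close> and the one whose value at \<open>q\<close> is \<open>1\<close>. They differ at \<open>q\<close> alone, so they
  have the same composite with \<open>f\<close>. For the units, the inverse of an order automorphism is again
  monotone, as the order is reflected as well as preserved.
\<close>

lemma definable_left_zeros: "definable_in A (left_zeros A)"
  unfolding definable_in_def left_zeros_def
  by (rule exI[of _ "All 1 (Equal (Times (Var 0) (Var 1)) (Var 0))"]) auto

lemma definable_monomorphisms: "definable_in A (monomorphisms A)"
  unfolding definable_in_def monomorphisms_def
  by (rule exI[of _ "All 1 (All 2 (Impl
        (Equal (Times (Var 0) (Var 1)) (Times (Var 0) (Var 2)))
        (Equal (Var 1) (Var 2))))"]) auto

lemma definable_epimorphisms: "definable_in A (epimorphisms A)"
  unfolding definable_in_def epimorphisms_def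
  by (rule exI[of _ "All 1 (All 2 (Impl
        (Equal (Times (Var 1) (Var 0)) (Times (Var 2) (Var 0)))
        (Equal (Var 1) (Var 2))))"]) auto

lemma definable_Units: "definable_in A (Units A)"
  unfolding definable_in_def Units_def
  by (rule exI[of _ "Ex 1 (Conj (Equal (Times (Var 1) (Var 0)) Unit)
        (Equal (Times (Var 0) (Var 1)) Unit))"]) auto

lemma End_Q_simps [simp]:
  "f \<in> carrier End_Q \<longleftrightarrow> mono f"
  "f \<otimes>\<^bsub>End_Q\<^esub> g = f \<circ> g"
  "\<one>\<^bsub>End_Q\<^esub> = id"
  by (simp_all add: End_Q_def)

lemma mono_const: "mono (\<lambda>_. c)"
  by (simp add: mono_def)

lemma const_Q_eq_left_zeros: "const_Q = left_zeros End_Q"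
proof (intro equalityI subsetI)
  fix g assume "g \<in> const_Q"
  then show "g \<in> left_zeros End_Q"
    by (auto simp: const_Q_def left_zeros_def mono_def)
next
  fix g assume "g \<in> left_zeros End_Q"
  then have "g \<circ> (\<lambda>_. 0) = g"
    by (simp add: left_zeros_def mono_const)
  then have "g x = g 0" for x
    by (metis comp_apply)
  then show "g \<in> const_Q"
    by (auto simp: const_Q_def)
qed

lemma inj_End_Q_eq_monomorphisms: "inj_End_Q = monomorphisms End_Q"
proof (intro equalityI subsetI)
  fix f assume "f \<in> inj_End_Q"
  then show "f \<in> monomorphisms End_Q"
    by (auto simp: inj_End_Q_def monomorphisms_def fun_eq_iff dest: injD)
next
  fix f assume f: "f \<in> monomorphisms End_Q"
  have "x = y" if "f x = f y" for x y
  proof -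
    have "f \<circ> (\<lambda>_. x) = f \<circ> (\<lambda>_::rat. y)"
      using that by (simp add: fun_eq_iff)
    then have "(\<lambda>_. x) = (\<lambda>_::rat. y)"
      using f by (simp add: monomorphisms_def mono_const)
    then show ?thesis
      by (rule fun_cong)
  qed
  then show "f \<in> inj_End_Q"
    using f by (auto simp: inj_End_Q_def monomorphisms_def inj_def)
qed

lemma surj_End_Q_eq_epimorphisms: "surj_End_Q = epimorphisms End_Q"
proof (intro equalityI subsetI)
  fix f assume "f \<in> surj_End_Q"
  then show "f \<in> epimorphisms End_Q"
    by (auto simp: surj_End_Q_def epimorphisms_def fun_eq_iff) (metis surjD)
next
  fix f assume f: "f \<in> epimorphisms End_Q"
  have "q \<in> range f" for q
  proof (rule ccontr)
    assume "q \<notin> range f"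
    then have ne: "f x \<noteq> q" for x
      by auto
    define g where "g = (\<lambda>x. if x < q then 0 else 1 :: rat)"
    define h where "h = (\<lambda>x. if x \<le> q then 0 else 1 :: rat)"
    have "mono g" "mono h"
      by (auto simp: g_def h_def mono_def)
    moreover have "g \<circ> f = h \<circ> f"
      using ne by (auto simp: g_def h_def fun_eq_iff less_le)
    ultimately have "g = h"
      using f by (simp add: epimorphisms_def)
    then have "g q = h q"
      by simp
    then show False
      by (simp add: g_def h_def)
  qed
  then show "f \<in> surj_End_Q"
    using f by (auto simp: surj_End_Q_def epimorphisms_def)
qed

lemma Aut_Q_eq_Units: "Aut_Q = Units End_Q"
proof (intro equalityI subsetI)
  fix f assume "f \<in> Aut_Q"
  then have bij: "bij f" and ord: "\<And>x y. x \<le> y \<longleftrightarrow> f x \<le> f y"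
    by (auto simp: Aut_Q_def)
  have "f (inv_into UNIV f x) = x" for x
    using bij by (simp add: bij_is_surj surj_f_inv_f)
  then have "mono (inv_into UNIV f)"
    unfolding mono_def by (metis ord)
  moreover have "mono f"
    using ord by (simp add: mono_def)
  moreover have "inv_into UNIV f \<circ> f = id" "f \<circ> inv_into UNIV f = id"
    using bij by (simp_all add: bij_is_inj bij_is_surj surj_iff[symmetric])
  ultimately show "f \<in> Units End_Q"
    by (auto simp: Units_def)
next
  fix f assume "f \<in> Units End_Q"
  then obtain g where "mono f" "mono g" and gf: "g \<circ> f = id" and fg: "f \<circ> g = id"
    by (auto simp: Units_def)
  have "x \<le> y" if "f x \<le> f y" for x y
    using monoD[OF \<open>mono g\<close> that] gf by (simp add: fun_eq_iff)
  then show "f \<in> Aut_Q"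
    using o_bij[OF gf fg] \<open>mono f\<close> by (auto simp: Aut_Q_def dest: monoD)
qed

theorem lemma3p2:
  shows "definable_in End_Q const_Q \<and> definable_in End_Q inj_End_Q
    \<and> definable_in End_Q surj_End_Q \<and> definable_in End_Q Aut_Q
    \<and> const_Q = left_zeros End_Q
    \<and> inj_End_Q = monomorphisms End_Q
    \<and> surj_End_Q = epimorphisms End_Q
    \<and> Aut_Q = Units End_Q"
  by (simp add: const_Q_eq_left_zeros inj_End_Q_eq_monomorphisms surj_End_Q_eq_epimorphisms
      Aut_Q_eq_Units definable_left_zeros definable_monomorphisms definable_epimorphisms
      definable_Units)

end
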